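(* Let $G$ be a local amoeba on $n$ vertices, with label set $X$, that has a leaf, and let $H$ be a rooted graph on $m$ vertices, with label set $B$, which is hang-symmetric at its root. Let $G*H$ be their comb product, with label set $B\times X$, and regard $S_m\wr S_n=\operatorname{Sym}(B)\wr\operatorname{Sym}(X)$ as a subgroup of $S_{mn}=\operatorname{Sym}(B\times X)$. Then: (1) $S_m\wr S_n\le\operatorname{Fer}(G*H)$. (2) $\operatorname{Fer}(G*H)$ is either equal to $S_m\wr S_n$ or to $S_{mn}$. (3) If there is some permutation in $\operatorname{Fer}(G*H)$ that does not respect the block system $\{B\times\{x\}\mid x\in X\}$, then $G*H$ is a local amoeba.
   Context: All graphs are finite and simple; a leaf is a vertex of degree $1$. A labeled graph $G$ comes with a bijection $\lambda:V(G)\to X$ onto a label set $X$; write $v_x=\lambda^{-1}(x)$ and $L_G=\{ij: v_iv_j\in E(G)\}$ (unordered pairs). For $\sigma\in\operatorname{Sym}(X)$, $G_\sigma$ is the graph on $V(G)$ with edge set $\{v_iv_j:\sigma(i)\sigma(j)\in L_G\}$. $\operatorname{Aut}(G)$ is identified with $\{\sigma\in\operatorname{Sym}(X): G_\sigma=G\}$. An edge-replacement $rs\to kl$ removes an edge $v_rv_s\in E(G)$ and adds $v_kv_l\in E(\overline G)\cup\{v_rv_s\}$; it is feasible if $G-v_rv_s+v_kv_l\cong G$. $R_G$ is the set of feasible edge-replacements $rs\to kl$ with $rs\ne kl$ together with the neutral replacement $\emptyset\to\emptyset$ (nothing changes). $\operatorname{Fer}_G(rs\to kl)=\{\sigma\in\operatorname{Sym}(X):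 G_\sigma=G-v_rv_s+v_kv_l\}$ and $\operatorname{Fer}_G(\emptyset\to\emptyset)=\operatorname{Aut}(G)$. $\mathcal{E}_G$ is the union of the sets $\operatorname{Fer}_G(e\to e')$ over all $e\to e'\in R_G$, and $\operatorname{Fer}(G)=\langle\mathcal{E}_G\rangle\le\operatorname{Sym}(X)$. $G$ is a local amoeba if $\operatorname{Fer}(G)=\operatorname{Sym}(X)$. For $i\in X$, $\mathcal{E}_G^i=\{\sigma\in\mathcal{E}_G:\sigma(i)=i\}$; the hang group of $G$ at $i$ is $\mathbf{H}_i(G)=\langle\mathcal{E}_G^i\cup\operatorname{Aut}(G)\rangle$, and $G$ is hang-symmetric at $v_i$ if $\mathbf{H}_i(G)=\operatorname{Sym}(X)$. Comb product: for a graph $G$ and a graph $H$ with root $v$, $G*H$ has vertex set $V(G)\times V(H)$, with an edge between $(u,v)$ and $(u',v)$ for each $uu'\in E(G)$, and an edge between $(u,w)$ and $(u,w')$ for each $u\in V(G)$ and $ww'\in E(H)$. If $G$, $H$ have label sets $X$, $B$, then $G*H$ has label set $B\times X$, where $(u,w)$ gets the label $(b,x)$ with $b$ the label of $w$ and $x$ the label of $u$. Wreath product: for $S\le\operatorname{Sym}(B)$, $T\le\operatorname{Sym}(X)$, $S\wr T\le\operatorname{Sym}(B\times X)$ is the subgroup generated by all maps $(b,x)\mapsto(b,\tau(x))$ with $\tau\in T$ and, for each $x_0\in X$ and $\sigma\in S$, the map sending $(b,x_0)\mapsto(\sigma(b),x_0)$ and fixing $(b,x)$ for $x\neq x_0$.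 A permutation of $B\times X$ respects $\{B\times\{x\}\mid x\in X\}$ if it maps each set $B\times\{x\}$ onto some $B\times\{y\}$. *)

theory Defs
  imports "HOL-Algebra.Sym_Groups"
begin

text \<open>
  This is \<^const>\<open>sym_group\<close> with an arbitrary set in place of
  \<open>{1..n}\<close>: permutations are total functions that are the identity outside \<open>X\<close>.
\<close>

definition Sym :: "'x set \<Rightarrow> ('x \<Rightarrow> 'x) monoid" where
  "Sym X = \<lparr>carrier = {\<sigma>. \<sigma> permutes X}, mult = (\<circ>), one = id\<rparr>"

lemma group_Sym: "group (Sym X)"
proof (rule groupI)
  fix \<sigma> assume "\<sigma> \<in> carrier (Sym X)"
  then have "Hilbert_Choice.inv \<sigma> \<in> carrier (Sym X)" "Hilbert_Choice.inv \<sigma> \<otimes>\<^bsub>Sym X\<^esub> \<sigma> = \<one>\<^bsub>Sym X\<^esub>"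
    by (auto simp: Sym_def permutes_inv permutes_inv_o)
  then show "\<exists>\<tau>\<in>carrier (Sym X). \<tau> \<otimes>\<^bsub>Sym X\<^esub> \<sigma> = \<one>\<^bsub>Sym X\<^esub>"
    by blast
qed (auto simp: Sym_def permutes_compose comp_assoc permutes_id)

lemma Sym_atLeastAtMost: "Sym {1..n} = sym_group n"
  by (simp add: Sym_def sym_group_def)

record 'v graph =
  verts :: "'v set"
  edges :: "'v set set"

definition simple_graph :: "('v, 'z) graph_scheme \<Rightarrow> bool" where
  "simple_graph G \<longleftrightarrow>
     finite (verts G) \<and>
     (\<forall>e\<in>edges G. \<exists>u\<in>verts G. \<exists>w\<in>verts G. u \<noteq> w \<and> e = {u, w})"

definition degree :: "('v, 'z) graph_scheme \<Rightarrow> 'v \<Rightarrow> nat" where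
  "degree G u = card {w \<in> verts G. {u, w} \<in> edges G}"

definition leaf :: "('v, 'z) graph_scheme \<Rightarrow> 'v \<Rightarrow> bool" where
  "leaf G u \<longleftrightarrow> u \<in> verts G \<and> degree G u = 1"

definition complement_edges :: "('v, 'z) graph_scheme \<Rightarrow> 'v set set" where
  "complement_edges G = {{u, w} | u w. u \<in> verts G \<and> w \<in> verts G \<and> u \<noteq> w} - edges G"

definition graph_iso :: "('v, 'y) graph_scheme \<Rightarrow> ('w, 'z) graph_scheme \<Rightarrow> bool"
    (infix "\<simeq>" 50) where
  "G \<simeq> G' \<longleftrightarrow>
     (\<exists>f. bij_betw f (verts G) (verts G') \<and>
          (\<forall>u\<in>verts G. \<forall>w\<in>verts G. {u, w} \<in> edges G \<longleftrightarrow> {f u, f w} \<in> edges G'))"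

record ('v, 'x) lgraph = "'v graph" +
  labels :: "'x set"
  label :: "'v \<Rightarrow> 'x"

definition labeled_graph :: "('v, 'x) lgraph \<Rightarrow> bool" where
  "labeled_graph G \<longleftrightarrow> simple_graph G \<and> bij_betw (label G) (verts G) (labels G)"

definition vertex :: "('v, 'x) lgraph \<Rightarrow> 'x \<Rightarrow> 'v" where
  "vertex G x = the_inv_into (verts G) (label G) x"

definition label_edges :: "('v, 'x) lgraph \<Rightarrow> 'x set set" where
  "label_edges G =
     {{i, j} | i j. i \<in> labels G \<and> j \<in> labels G \<and> {vertex G i, vertex G j} \<in> edges G}"

definition relabel :: "('v, 'x) lgraph \<Rightarrow> ('x \<Rightarrow> 'x) \<Rightarrow> ('v, 'x) lgraph" where
  "relabel G \<sigma> = G\<lparr>edges :=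
     {{vertex G i, vertex G j} | i j.
        i \<in> labels G \<and> j \<in> labels G \<and> {\<sigma> i, \<sigma> j} \<in> label_edges G}\<rparr>"

definition Aut :: "('v, 'x) lgraph \<Rightarrow> ('x \<Rightarrow> 'x) set" where
  "Aut G = {\<sigma> \<in> carrier (Sym (labels G)). relabel G \<sigma> = G}"

text \<open>
  The edge-replacement \<open>rs \<rightarrow> kl\<close> is the pair \<open>({r, s}, {k, l})\<close> of
  unordered pairs of labels; the neutral one is the pair \<open>({}, {})\<close>.
\<close>

definition replace_edge :: "('v, 'x) lgraph \<Rightarrow> 'x set \<Rightarrow> 'x set \<Rightarrow> ('v, 'x) lgraph" where
  "replace_edge G e e' = G\<lparr>edges := (edges G - {vertex G ` e}) \<union> {vertex G ` e'}\<rparr>"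

definition edge_replacement :: "('v, 'x) lgraph \<Rightarrow> 'x set \<Rightarrow> 'x set \<Rightarrow> bool" where
  "edge_replacement G e e' \<longleftrightarrow>
     e \<subseteq> labels G \<and> e' \<subseteq> labels G \<and>
     vertex G ` e \<in> edges G \<and>
     vertex G ` e' \<in> complement_edges G \<union> {vertex G ` e}"

definition feasible :: "('v, 'x) lgraph \<Rightarrow> 'x set \<Rightarrow> 'x set \<Rightarrow> bool" where
  "feasible G e e' \<longleftrightarrow> edge_replacement G e e' \<and> replace_edge G e e' \<simeq> G"

definition feasible_replacements :: "('v, 'x) lgraph \<Rightarrow> ('x set \<times> 'x set) set" where
  "feasible_replacements G = {(e, e'). feasible G e e' \<and> e \<noteq> e'} \<union> {({}, {})}"

definition Fer_set :: "('v, 'x) lgraph \<Rightarrow> 'x set \<times> 'x set \<Rightarrow> ('x \<Rightarrow> 'x) set" where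
  "Fer_set G r =
     (if r = ({}, {}) then Aut G
      else {\<sigma> \<in> carrier (Sym (labels G)). relabel G \<sigma> = replace_edge G (fst r) (snd r)})"

definition all_Fer :: "('v, 'x) lgraph \<Rightarrow> ('x \<Rightarrow> 'x) set" where
  "all_Fer G = (\<Union>r\<in>feasible_replacements G. Fer_set G r)"

definition Fer :: "('v, 'x) lgraph \<Rightarrow> ('x \<Rightarrow> 'x) set" where
  "Fer G = generate (Sym (labels G)) (all_Fer G)"

definition local_amoeba :: "('v, 'x) lgraph \<Rightarrow> bool" where
  "local_amoeba G \<longleftrightarrow> Fer G = carrier (Sym (labels G))"

definition hang_group :: "('v, 'x) lgraph \<Rightarrow> 'x \<Rightarrow> ('x \<Rightarrow> 'x) set" where
  "hang_group G i = generate (Sym (labels G)) ({\<sigma> \<in> all_Fer G. \<sigma> i = i} \<union> Aut G)"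

definition hang_symmetric :: "('v, 'x) lgraph \<Rightarrow> 'v \<Rightarrow> bool" where
  "hang_symmetric G v \<longleftrightarrow> hang_group G (label G v) = carrier (Sym (labels G))"

definition comb_product :: "('u, 'x) lgraph \<Rightarrow> ('w, 'b) lgraph \<Rightarrow> 'w \<Rightarrow> ('u \<times> 'w, 'b \<times> 'x) lgraph"
  where
  "comb_product G H v =
     \<lparr>verts = verts G \<times> verts H,
      edges = {{(u, v), (u', v)} | u u'. {u, u'} \<in> edges G} \<union>
              {{(u, w), (u, w')} | u w w'. u \<in> verts G \<and> {w, w'} \<in> edges H},
      labels = labels H \<times> labels G,
      label = (\<lambda>(u, w). (label H w, label G u))\<rparr>"

lemma labeled_graph_comb_product:
  assumes "labeled_graph G" "labeled_graph H" "v \<in> verts H"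
  shows "labeled_graph (comb_product G H v)"
proof -
  have G: "simple_graph G" "bij_betw (label G) (verts G) (labels G)"
    and H: "simple_graph H" "bij_betw (label H) (verts H) (labels H)"
    using assms by (auto simp: labeled_graph_def)
  have "\<exists>p\<in>verts G \<times> verts H. \<exists>q\<in>verts G \<times> verts H. p \<noteq> q \<and> e = {p, q}"
    if "e \<in> edges (comb_product G H v)" for e
  proof -
    from that consider
        u u' where "{u, u'} \<in> edges G" "e = {(u, v), (u', v)}"
      | u w w' where "u \<in> verts G" "{w, w'} \<in> edges H" "e = {(u, w), (u, w')}"
      by (auto simp: comb_product_def)
    then show ?thesis
    proof cases
      case 1
      then have "u \<in> verts G" "u' \<in> verts G" "u \<noteq> u'"
        using G(1) unfolding simple_graph_def by (force simp: doubleton_eq_iff)+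
      then show ?thesis using 1 assms(3) by blast
    next
      case 2
      then have "w \<in> verts H" "w' \<in> verts H" "w \<noteq> w'"
        using H(1) unfolding simple_graph_def by (force simp: doubleton_eq_iff)+
      then show ?thesis using 2 by blast
    qed
  qed
  then have "simple_graph (comb_product G H v)"
    using G(1) H(1) by (auto simp: simple_graph_def comb_product_def)
  moreover have "bij_betw (\<lambda>(u, w). (label H w, label G u))
      (verts G \<times> verts H) (labels H \<times> labels G)"
  proof -
    have "bij_betw (prod.swap \<circ> map_prod (label G) (label H))
        (verts G \<times> verts H) (labels H \<times> labels G)"
      by (rule bij_betw_trans[OF bij_betw_map_prod[OF G(2) H(2)]])
        (auto simp: bij_betw_def inj_on_def)
    moreover have "prod.swap \<circ> map_prod (label G) (label H)
        = (\<lambda>(u, w). (label H w, label G u))"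
      by auto
    ultimately show ?thesis by simp
  qed
  ultimately show ?thesis
    by (simp add: labeled_graph_def comb_product_def)
qed

text \<open>
  The guard in \<open>wreath_top\<close> makes the map the identity outside \<open>B \<times> X\<close>; in
  \<open>wreath_base\<close> this is automatic, since \<open>\<sigma>\<close> is the identity outside \<open>B\<close>
  and \<open>x\<^sub>0 \<in> X\<close>.
\<close>

definition wreath_top :: "'b set \<Rightarrow> ('x \<Rightarrow> 'x) \<Rightarrow> 'b \<times> 'x \<Rightarrow> 'b \<times> 'x" where
  "wreath_top B \<tau> = (\<lambda>(b, x). if b \<in> B then (b, \<tau> x) else (b, x))"

definition wreath_base :: "'x \<Rightarrow> ('b \<Rightarrow> 'b) \<Rightarrow> 'b \<times> 'x \<Rightarrow> 'b \<times> 'x" where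
  "wreath_base x\<^sub>0 \<sigma> = (\<lambda>(b, x). if x = x\<^sub>0 then (\<sigma> b, x) else (b, x))"

definition wreath_product ::
    "'b set \<Rightarrow> 'x set \<Rightarrow> ('b \<Rightarrow> 'b) set \<Rightarrow> ('x \<Rightarrow> 'x) set \<Rightarrow> ('b \<times> 'x \<Rightarrow> 'b \<times> 'x) set"
  where
  "wreath_product B X S T =
     generate (Sym (B \<times> X))
       ({wreath_top B \<tau> | \<tau>. \<tau> \<in> T} \<union> {wreath_base x\<^sub>0 \<sigma> | x\<^sub>0 \<sigma>. x\<^sub>0 \<in> X \<and> \<sigma> \<in> S})"

definition respects_blocks :: "'b set \<Rightarrow> 'x set \<Rightarrow> ('b \<times> 'x \<Rightarrow> 'b \<times> 'x) \<Rightarrow> bool" where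
  "respects_blocks B X \<pi> \<longleftrightarrow> (\<forall>x\<in>X. \<exists>y\<in>X. \<pi> ` (B \<times> {x}) = B \<times> {y})"

end

theory Submission
  imports Defs
begin

text \<open>
  On labels, \<open>\<E>\<^sub>G\<close> consists of the permutations that map all edges but at most one to
  edges. Hence a permutation in \<open>\<E>\<^sub>G\<close> applied to the copies of \<open>H\<close>, a
  permutation in \<open>\<E>\<^sub>H\<close> that fixes the root applied in one copy, and an automorphism of
  \<open>H\<close> applied in the copy at a leaf all lie in \<open>\<E>\<close> of the comb product. The last two
  kinds generate \<open>Sym(B)\<close> in the copy at the leaf, and conjugation by the first kind moves
  it to every copy, which gives the wreath product.

  The wreath product is maximal: if a larger group contains a permutation that breaks a block,
  conjugating a transposition inside that block gives a transposition across two blocks; the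
  wreath product is transitive on such pairs, so all transpositions occur.
\<close>

section \<open>Edge-replacements on labels\<close>

lemma carrier_Sym [simp]: "carrier (Sym X) = {\<sigma>. \<sigma> permutes X}"
  and mult_Sym [simp]: "\<sigma> \<otimes>\<^bsub>Sym X\<^esub> \<tau> = \<sigma> \<circ> \<tau>"
  and one_Sym [simp]: "\<one>\<^bsub>Sym X\<^esub> = id"
  by (simp_all add: Sym_def)

section \<open>Passing between vertices and labels\<close>

lemma bij_betw_vertex:
  "labeled_graph G \<Longrightarrow> bij_betw (vertex G) (labels G) (verts G)"
  unfolding labeled_graph_def vertex_def [abs_def] using bij_betw_the_inv_into by blast

lemma vertex_label:
  "labeled_graph G \<Longrightarrow> u \<in> verts G \<Longrightarrow> vertex G (label G u) = u"
  by (auto simp: labeled_graph_def vertex_def bij_betw_def the_inv_into_f_f)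

lemma label_vertex:
  "labeled_graph G \<Longrightarrow> i \<in> labels G \<Longrightarrow> label G (vertex G i) = i"
  by (auto simp: labeled_graph_def vertex_def bij_betw_def f_the_inv_into_f)

lemma label_in_labels: "labeled_graph G \<Longrightarrow> u \<in> verts G \<Longrightarrow> label G u \<in> labels G"
  by (auto simp: labeled_graph_def bij_betw_def)

lemma vertex_in_verts: "labeled_graph G \<Longrightarrow> i \<in> labels G \<Longrightarrow> vertex G i \<in> verts G"
  using bij_betw_vertex by (auto simp: bij_betw_def)

lemma finite_labels: "labeled_graph G \<Longrightarrow> finite (labels G)"
  by (auto simp: labeled_graph_def simple_graph_def dest: bij_betw_finite)

lemma labeled_graph_edgeE:
  assumes "labeled_graph G" "e \<in> edges G"
  obtains u w where "u \<in> verts G" "w \<in> verts G" "u \<noteq> w" "e = {u, w}"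
  using assms by (auto simp: labeled_graph_def simple_graph_def)

lemma label_edges_eq:
  assumes "labeled_graph G"
  shows "label_edges G = (`) (label G) ` edges G"
proof (intro subset_antisym subsetI)
  fix e assume "e \<in> label_edges G"
  then obtain i j where ij: "e = {i, j}" "i \<in> labels G" "j \<in> labels G"
    "{vertex G i, vertex G j} \<in> edges G"
    by (auto simp: label_edges_def)
  then have "e = label G ` {vertex G i, vertex G j}"
    using assms by (simp add: label_vertex)
  with ij show "e \<in> (`) (label G) ` edges G" by blast
next
  fix e assume "e \<in> (`) (label G) ` edges G"
  then obtain f where f: "f \<in> edges G" "e = label G ` f" by auto
  moreover obtain u w where "u \<in> verts G" "w \<in> verts G" "f = {u, w}"
    using assms f(1) by (elim labeled_graph_edgeE)
  ultimately show "e \<in> label_edges G"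
    unfolding label_edges_def using assms
    by (intro CollectI exI [of _ "label G u"] exI [of _ "label G w"])
      (simp add: label_in_labels vertex_label)
qed

lemma edges_eq:
  assumes "labeled_graph G"
  shows "edges G = (`) (vertex G) ` label_edges G"
proof -
  have "vertex G ` label G ` e = e" if "e \<in> edges G" for e
  proof -
    obtain u w where "u \<in> verts G" "w \<in> verts G" "e = {u, w}"
      using assms \<open>e \<in> edges G\<close> by (elim labeled_graph_edgeE)
    then show ?thesis using assms by (simp add: vertex_label)
  qed
  then show ?thesis
    by (simp add: label_edges_eq [OF assms] image_image cong: image_cong)
qed

lemma label_edgeE:
  assumes "labeled_graph G" "e \<in> label_edges G"
  obtains i j where "i \<in> labels G" "j \<in> labels G" "i \<noteq> j" "e = {i, j}"
proof -
  obtain f where "f \<in> edges G" "e = label G ` f"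
    using assms label_edges_eq by blast
  moreover obtain u w where "u \<in> verts G" "w \<in> verts G" "u \<noteq> w" "f = {u, w}"
    using \<open>f \<in> edges G\<close> assms(1) by (elim labeled_graph_edgeE)
  moreover have "inj_on (label G) (verts G)"
    using assms(1) by (simp add: labeled_graph_def bij_betw_def)
  ultimately show ?thesis
    using that [of "label G u" "label G w"] assms(1) by (auto simp: label_in_labels inj_on_def)
qed

lemma label_edges_subset: "labeled_graph G \<Longrightarrow> label_edges G \<subseteq> Pow (labels G)"
  by (auto elim: label_edgeE)

text \<open>Translating sets of labels into sets of vertices loses nothing, so edge sets of graphs
  on the same vertices can be compared through their label pairs.\<close>

lemma inj_on_vertex_image:
  "labeled_graph G \<Longrightarrow> inj_on ((`) (vertex G)) (Pow (labels G))"
  by (simp add: bij_betw_imp_inj_on [OF bij_betw_vertex] inj_on_image_Pow)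

text \<open>A set whose image under the injective \<sigma> is an edge is itself a pair, so ranging
  over all sets of labels adds nothing: the relabeled edges are exactly the preimages of the label
  edges.\<close>

lemma edges_relabel:
  assumes "labeled_graph G" "\<sigma> permutes labels G"
  shows "edges (relabel G \<sigma>) = (`) (vertex G) ` {e \<in> Pow (labels G). \<sigma> ` e \<in> label_edges G}"
proof (intro subset_antisym subsetI)
  fix f assume "f \<in> edges (relabel G \<sigma>)"
  then obtain i j where ij: "f = {vertex G i, vertex G j}" "i \<in> labels G" "j \<in> labels G"
    "{\<sigma> i, \<sigma> j} \<in> label_edges G"
    by (auto simp: relabel_def)
  then have "f = vertex G ` {i, j}" "{i, j} \<in> {e \<in> Pow (labels G). \<sigma> ` e \<in> label_edges G}"
    by auto
  then show "f \<in> (`) (vertex G) ` {e \<in> Pow (labels G). \<sigma> ` e \<in> label_edges G}" by blast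
next
  fix f assume "f \<in> (`) (vertex G) ` {e \<in> Pow (labels G). \<sigma> ` e \<in> label_edges G}"
  then obtain e where e: "f = vertex G ` e" "e \<subseteq> labels G" "\<sigma> ` e \<in> label_edges G"
    by auto
  obtain p q where "\<sigma> ` e = {p, q}"
    using assms(1) e(3) by (elim label_edgeE)
  moreover have "e = Hilbert_Choice.inv \<sigma> ` \<sigma> ` e"
    using assms(2) by (simp add: permutes_inj image_inv_f_f)
  ultimately have "e = {Hilbert_Choice.inv \<sigma> p, Hilbert_Choice.inv \<sigma> q}"
    by simp
  then obtain i j where "e = {i, j}" by blast
  with e have "f = {vertex G i, vertex G j} \<and> i \<in> labels G \<and> j \<in> labels G \<and>
      {\<sigma> i, \<sigma> j} \<in> label_edges G"
    by simp
  then show "f \<in> edges (relabel G \<sigma>)"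
    by (auto simp: relabel_def)
qed

text \<open>The vertex labeled \<open>i\<close> goes to the vertex labeled
  \<open>\<sigma> i\<close>. Any replacement realized by a relabeling is therefore feasible.\<close>

lemma relabel_iso:
  assumes "labeled_graph G" "\<sigma> permutes labels G"
  shows "relabel G \<sigma> \<simeq> G"
proof -
  let ?f = "\<lambda>u. vertex G (\<sigma> (label G u))"
  have "bij_betw (vertex G \<circ> (\<sigma> \<circ> label G)) (verts G) (verts G)"
    using assms bij_betw_vertex [OF assms(1)]
    by (intro bij_betw_trans) (auto simp: labeled_graph_def permutes_imp_bij)
  moreover have "{u, w} \<in> edges (relabel G \<sigma>) \<longleftrightarrow> {?f u, ?f w} \<in> edges G"
    if uw: "u \<in> verts G" "w \<in> verts G" for u w
  proof -
    let ?i = "label G u" and ?j = "label G w"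
    have ij: "?i \<in> labels G" "?j \<in> labels G" "\<sigma> ?i \<in> labels G" "\<sigma> ?j \<in> labels G"
      using assms uw by (auto simp: label_in_labels permutes_in_image)
    have "{u, w} = vertex G ` {?i, ?j}"
      using assms uw by (simp add: vertex_label)
    then have "{u, w} \<in> edges (relabel G \<sigma>) \<longleftrightarrow>
        {?i, ?j} \<in> {e \<in> Pow (labels G). \<sigma> ` e \<in> label_edges G}"
      unfolding edges_relabel [OF assms]
      using ij by (simp only:) (rule inj_on_image_mem_iff [OF inj_on_vertex_image [OF assms(1)]], auto)
    also have "\<dots> \<longleftrightarrow> {\<sigma> ?i, \<sigma> ?j} \<in> label_edges G"
      using ij by simp
    also have "\<dots> \<longleftrightarrow> vertex G ` {\<sigma> ?i, \<sigma> ?j} \<in> edges G"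
      unfolding edges_eq [OF assms(1)]
      by (rule inj_on_image_mem_iff [symmetric, OF inj_on_vertex_image [OF assms(1)]])
        (use ij label_edges_subset [OF assms(1)] in auto)
    finally show ?thesis by simp
  qed
  ultimately show ?thesis
    unfolding graph_iso_def by (intro exI [of _ ?f]) (auto simp: relabel_def comp_def)
qed

lemma edges_update_eq_self_iff: "G\<lparr>edges := A\<rparr> = G \<longleftrightarrow> A = edges G"
  by (cases G) simp

lemma edges_update_eq_iff: "G\<lparr>edges := A\<rparr> = G\<lparr>edges := A'\<rparr> \<longleftrightarrow> A = A'"
  by (cases G) simp

lemma relabel_eq_self_iff:
  assumes "labeled_graph G" "\<sigma> permutes labels G"
  shows "relabel G \<sigma> = G \<longleftrightarrow>
    {e \<in> Pow (labels G). \<sigma> ` e \<in> label_edges G} = label_edges G"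
proof -
  have "relabel G \<sigma> = G \<longleftrightarrow> edges (relabel G \<sigma>) = edges G"
    by (simp add: relabel_def edges_update_eq_self_iff)
  also have "\<dots> \<longleftrightarrow> {e \<in> Pow (labels G). \<sigma> ` e \<in> label_edges G} = label_edges G"
    unfolding edges_relabel [OF assms] edges_eq [OF assms(1)]
    by (rule inj_on_image_eq_iff [OF inj_on_vertex_image [OF assms(1)]])
      (use label_edges_subset [OF assms(1)] in auto)
  finally show ?thesis .
qed

text \<open>Relabeling and replacement alter only the edge field, so the two graphs agree as soon as
  their edge sets do; injectivity of \<open>vertex G\<close> then cancels the passage to
  vertices.\<close>

lemma relabel_eq_replace_edge_iff:
  assumes "labeled_graph G" "\<sigma> permutes labels G" "e \<subseteq> labels G" "e' \<subseteq> labels G"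
  shows "relabel G \<sigma> = replace_edge G e e' \<longleftrightarrow>
    {f \<in> Pow (labels G). \<sigma> ` f \<in> label_edges G} = insert e' (label_edges G - {e})"
proof -
  have "edges (replace_edge G e e') = (`) (vertex G) ` insert e' (label_edges G - {e})"
  proof -
    have "(`) (vertex G) ` (label_edges G - {e}) =
        (`) (vertex G) ` label_edges G - (`) (vertex G) ` {e}"
      by (rule inj_on_image_set_diff [OF inj_on_vertex_image [OF assms(1)]])
        (use assms(3) label_edges_subset [OF assms(1)] in auto)
    then show ?thesis by (simp add: replace_edge_def edges_eq [OF assms(1)])
  qed
  moreover have "relabel G \<sigma> = replace_edge G e e' \<longleftrightarrow>
      edges (relabel G \<sigma>) = edges (replace_edge G e e')"
    by (simp add: relabel_def replace_edge_def edges_update_eq_iff)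
  moreover have "insert e' (label_edges G - {e}) \<subseteq> Pow (labels G)"
    using assms(4) label_edges_subset [OF assms(1)] by auto
  ultimately show ?thesis
    by (simp only: edges_relabel [OF assms(1,2)] Collect_subset
        inj_on_image_eq_iff [OF inj_on_vertex_image [OF assms(1)]])
qed

lemma Aut_maps_edges:
  assumes "labeled_graph G" "\<sigma> \<in> Aut G" "e \<in> label_edges G"
  shows "\<sigma> ` e \<in> label_edges G"
proof -
  have "\<sigma> permutes labels G" "relabel G \<sigma> = G" using assms(2) by (simp_all add: Aut_def)
  then have "{e \<in> Pow (labels G). \<sigma> ` e \<in> label_edges G} = label_edges G"
    using relabel_eq_self_iff [OF assms(1)] by simp
  then show ?thesis using assms(3) by blast
qed

text \<open>
  Comparing the numbers of edges, a relabeling that keeps all edges but one also creates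
  exactly one edge, so the feasibility of the replacement need not be checked separately.
\<close>

lemma all_Fer_iff:
  assumes G: "labeled_graph G"
  shows "\<sigma> \<in> all_Fer G \<longleftrightarrow> \<sigma> permutes labels G \<and>
    (\<exists>e. \<forall>f\<in>label_edges G. f \<noteq> e \<longrightarrow> \<sigma> ` f \<in> label_edges G)"
    (is "_ \<longleftrightarrow> ?R")
proof
  assume "\<sigma> \<in> all_Fer G"
  then consider "\<sigma> \<in> Aut G"
    | e e' where "feasible G e e'" "\<sigma> permutes labels G" "relabel G \<sigma> = replace_edge G e e'"
    by (fastforce simp: all_Fer_def Fer_set_def feasible_replacements_def split: if_splits)
  then show ?R
  proof cases
    case 1
    \<comment> \<open>An automorphism loses no edge, so any \<open>e\<close> is a witness.\<close>
    then show ?thesis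
      using Aut_maps_edges [OF G] by (auto simp: Aut_def)
  next
    case 2
    then have "{f \<in> Pow (labels G). \<sigma> ` f \<in> label_edges G} = insert e' (label_edges G - {e})"
      using relabel_eq_replace_edge_iff [OF G]
      by (auto simp: feasible_def edge_replacement_def)
    with 2 show ?thesis by auto
  qed
next
  let ?L = "label_edges G"
  let ?P = "{f \<in> Pow (labels G). \<sigma> ` f \<in> ?L}"
  assume ?R
  then obtain e where \<sigma>: "\<sigma> permutes labels G" and
    e: "\<And>f. f \<in> ?L \<Longrightarrow> f \<noteq> e \<Longrightarrow> \<sigma> ` f \<in> ?L"
    by auto
  note L = label_edges_subset [OF G]
  have fin: "finite ?L" "finite ?P"
    using finite_labels [OF G] L by (auto intro: finite_subset)
  \<comment> \<open>\<open>?P\<close> is the full preimage of \<open>?L\<close> under the action of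
    \<sigma> on sets of labels, so the two have the same size.\<close>
  have "bij_betw ((`) \<sigma>) ?P ?L"
    unfolding bij_betw_def
  proof (intro conjI subset_antisym subsetI)
    show "inj_on ((`) \<sigma>) ?P"
      using permutes_inj [OF \<sigma>] by (auto simp: inj_on_def inj_image_eq_iff)
  next
    fix f assume f: "f \<in> ?L"
    let ?g = "Hilbert_Choice.inv \<sigma> ` f"
    have "\<sigma> ` ?g = f"
      using permutes_surj [OF \<sigma>] by (simp add: image_f_inv_f)
    moreover have "?g \<subseteq> labels G"
      using f L permutes_image [OF permutes_inv [OF \<sigma>]] by blast
    ultimately show "f \<in> (`) \<sigma> ` ?P" using f by (intro image_eqI [of _ _ ?g]) auto
  qed auto
  then have card_eq: "card ?P = card ?L" by (rule bij_betw_same_card)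
  show "\<sigma> \<in> all_Fer G"
  proof (cases "?L \<subseteq> ?P")
    case True
    then have "?P = ?L"
      using fin card_eq card_subset_eq [of ?P ?L] by auto
    then have "\<sigma> \<in> Aut G"
      using relabel_eq_self_iff [OF G \<sigma>] \<sigma> by (simp add: Aut_def)
    then show ?thesis
      by (auto simp: all_Fer_def Fer_set_def feasible_replacements_def)
  next
    case False
    then have eL: "e \<in> ?L" and eP: "e \<notin> ?P"
      using e L by auto
    have sub: "?L - {e} \<subseteq> ?P"
      using e L by auto
    \<comment> \<open>\<open>?L - {e}\<close> accounts for all but one of the
      \<open>card ?P = card ?L\<close> preimages; the one that remains is the added edge.\<close>
    then have "card (?P - (?L - {e})) = 1"
      using fin eL card_eq card_gt_0_iff [of ?L] by (subst card_Diff_subset) auto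
    then obtain e' where e': "?P - (?L - {e}) = {e'}"
      by (auto simp: card_1_singleton_iff)
    then have P: "?P = insert e' (?L - {e})" and e'P: "e' \<in> ?P" and "e' \<noteq> e"
      using sub eP by auto
    then have e'L: "e' \<notin> ?L" using e' by auto
    have sub': "e \<subseteq> labels G" "e' \<subseteq> labels G"
      using eL L e'P by auto
    have eq: "relabel G \<sigma> = replace_edge G e e'"
      using relabel_eq_replace_edge_iff [OF G \<sigma> sub'] P by simp
    have "vertex G ` e' \<in> complement_edges G"
    proof -
      have "\<sigma> ` e' \<in> ?L" using e'P by simp
      \<comment> \<open>\<sigma> preserves sizes, so \<open>e'\<close> inherits from its image the
        property of being a pair of distinct labels, as an element of
        \<open>complement_edges G\<close> must be.\<close>
      then have "card (\<sigma> ` e') = 2"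
        using G by (elim label_edgeE) (auto simp: card_2_iff)
      then have "card e' = 2"
        using permutes_inj_on [OF \<sigma>] by (simp add: card_image)
      then obtain i j where ij: "e' = {i, j}" "i \<noteq> j"
        by (auto simp: card_2_iff)
      then have "vertex G i \<noteq> vertex G j"
        using sub' bij_betw_imp_inj_on [OF bij_betw_vertex [OF G]] by (auto simp: inj_on_def)
      moreover have "vertex G ` e' \<notin> edges G"
        unfolding edges_eq [OF G]
        using e'L sub' L inj_on_image_mem_iff [OF inj_on_vertex_image [OF G], of e' ?L] by auto
      ultimately show ?thesis
        unfolding complement_edges_def using ij sub' G vertex_in_verts [OF G] by auto
    qed
    moreover have "vertex G ` e \<in> edges G"
      using eL by (auto simp: edges_eq [OF G])
    moreover have "replace_edge G e e' \<simeq> G"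
      using relabel_iso [OF G \<sigma>] eq by simp
    ultimately have "feasible G e e'"
      using sub' by (simp add: feasible_def edge_replacement_def)
    \<comment> \<open>Edges are nonempty, so \<open>(e, e')\<close> is not the neutral replacement
      and \<open>Fer_set\<close> takes its second branch.\<close>
    moreover have "\<sigma> \<in> Fer_set G (e, e')"
      using eq \<sigma> eL G by (auto simp: Fer_set_def elim: label_edgeE)
    ultimately show ?thesis
      using \<open>e' \<noteq> e\<close> by (auto simp: all_Fer_def feasible_replacements_def)
  qed
qed

section \<open>The comb product\<close>

text \<open>Labels put the \<open>H\<close>-coordinate first. The edges of \<open>G\<close> thus lie
  in the row of the root label, and each copy of \<open>H\<close> fills a block
  \<open>labels H \<times> {x}\<close>. All later arguments split into these two kinds of
  edges.\<close>

lemma label_edges_comb_product: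
  assumes G: "labeled_graph G" and H: "labeled_graph H" and v: "v \<in> verts H"
  shows "label_edges (comb_product G H v) =
    (\<lambda>e. {label H v} \<times> e) ` label_edges G \<union>
    (\<lambda>(e, x). e \<times> {x}) ` (label_edges H \<times> labels G)"
proof -
  let ?l = "\<lambda>(u, w). (label H w, label G u)"
  have "label_edges (comb_product G H v) = (`) ?l ` edges (comb_product G H v)"
    by (simp add: label_edges_eq [OF labeled_graph_comb_product [OF assms]])
      (simp add: comb_product_def)
  also have "edges (comb_product G H v) =
      (\<lambda>e. e \<times> {v}) ` edges G \<union> (\<lambda>(u, e). {u} \<times> e) ` (verts G \<times> edges H)"
  proof -
    have "{{(u, v), (u', v)} | u u'. {u, u'} \<in> edges G} = (\<lambda>e. e \<times> {v}) ` edges G"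
      (is "?A = ?B")
    proof (rule subset_antisym; rule subsetI)
      fix e assume "e \<in> ?A"
      then obtain u u' where "{u, u'} \<in> edges G" "e = {u, u'} \<times> {v}" by auto
      then show "e \<in> ?B" by blast
    next
      fix e assume "e \<in> ?B"
      then obtain f where "f \<in> edges G" "e = f \<times> {v}" by auto
      with G show "e \<in> ?A" by (elim labeled_graph_edgeE) auto
    qed
    moreover have "{{(u, w), (u, w')} | u w w'. u \<in> verts G \<and> {w, w'} \<in> edges H} =
        (\<lambda>(u, e). {u} \<times> e) ` (verts G \<times> edges H)"
      (is "?A = ?B")
    proof (rule subset_antisym; rule subsetI)
      fix e assume "e \<in> ?A"
      then obtain u w w' where "u \<in> verts G" "{w, w'} \<in> edges H" "e = {u} \<times> {w, w'}" by auto
      then show "e \<in> ?B" by (intro image_eqI [of _ _ "(u, {w, w'})"]) auto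
    next
      fix e assume "e \<in> ?B"
      then obtain u f where "u \<in> verts G" "f \<in> edges H" "e = {u} \<times> f" by auto
      with H show "e \<in> ?A" by (elim labeled_graph_edgeE) auto
    qed
    ultimately show ?thesis by (simp add: comb_product_def)
  qed
  also have "(`) ?l ` ((\<lambda>e. e \<times> {v}) ` edges G \<union> (\<lambda>(u, e). {u} \<times> e) ` (verts G \<times> edges H)) =
      (\<lambda>e. {label H v} \<times> label G ` e) ` edges G \<union>
      (\<lambda>(u, e). label H ` e \<times> {label G u}) ` (verts G \<times> edges H)"
  proof -
    have "?l ` (e \<times> {v}) = {label H v} \<times> label G ` e" for e by auto
    moreover have "?l ` ({u} \<times> e) = label H ` e \<times> {label G u}" for u e by auto
    ultimately show ?thesis
      by (simp add: image_Un image_image case_prod_unfold)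
  qed
  also have "(\<lambda>e. {label H v} \<times> label G ` e) ` edges G =
      (\<lambda>e. {label H v} \<times> e) ` label_edges G"
    by (simp add: label_edges_eq [OF G] image_image)
  also have "(\<lambda>(u, e). label H ` e \<times> {label G u}) ` (verts G \<times> edges H) =
      (\<lambda>(e, x). e \<times> {x}) ` (label_edges H \<times> labels G)"
  proof -
    \<comment> \<open>A copy of \<open>H\<close> is indexed by a vertex of \<open>G\<close> on the
      left and by the label of that vertex on the right.\<close>
    have "labels G = label G ` verts G"
      using G by (auto simp: labeled_graph_def bij_betw_def)
    then show ?thesis
      unfolding label_edges_eq [OF H] by (auto simp: image_iff)
  qed
  finally show ?thesis .
qed

lemma label_edge_comb_productE:
  assumes "labeled_graph G" "labeled_graph H" "v \<in> verts H"
    and "f \<in> label_edges (comb_product G H v)"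
  obtains g where "g \<in> label_edges G" "f = {label H v} \<times> g"
  | g x where "g \<in> label_edges H" "x \<in> labels G" "f = g \<times> {x}"
  using assms(4) unfolding label_edges_comb_product [OF assms(1-3)]
  by (elim UnE imageE SigmaE) (auto intro: that)

lemma labels_comb_product [simp]: "labels (comb_product G H v) = labels H \<times> labels G"
  by (simp add: comb_product_def)

section \<open>Generators of the wreath product acting on the comb product\<close>

lemma wreath_top_permutes:
  "\<tau> permutes X \<Longrightarrow> wreath_top B \<tau> permutes B \<times> X"
proof (rule bij_imp_permutes)
  assume \<tau>: "\<tau> permutes X"
  show "bij_betw (wreath_top B \<tau>) (B \<times> X) (B \<times> X)"
    using \<tau> permutes_inverses [OF \<tau>] permutes_in_image [OF permutes_inv [OF \<tau>]]
    by (intro bij_betw_byWitness [where f' = "wreath_top B (Hilbert_Choice.inv \<tau>)"])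
      (auto simp: wreath_top_def permutes_in_image)
qed (auto simp: wreath_top_def dest: permutes_not_in split: if_splits)

lemma wreath_base_permutes:
  "\<sigma> permutes B \<Longrightarrow> x \<in> X \<Longrightarrow> wreath_base x \<sigma> permutes B \<times> X"
proof (rule bij_imp_permutes)
  assume \<sigma>: "\<sigma> permutes B"
  show "bij_betw (wreath_base x \<sigma>) (B \<times> X) (B \<times> X)"
    using \<sigma> permutes_inverses [OF \<sigma>] permutes_in_image [OF permutes_inv [OF \<sigma>]]
    by (intro bij_betw_byWitness [where f' = "wreath_base x (Hilbert_Choice.inv \<sigma>)"])
      (auto simp: wreath_base_def permutes_in_image split: if_splits)
qed (auto simp: wreath_base_def dest: permutes_not_in split: if_splits)

text \<open>A homomorphism carries a generated group to the group generated by the images, so only a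
  generating set of \<open>Sym X\<close> has to be placed in \<open>Fer\<close>.\<close>

lemma group_hom_wreath_top: "group_hom (Sym X) (Sym (B \<times> X)) (wreath_top B)"
  by (intro group_hom.intro group_hom_axioms.intro group_Sym homI)
    (auto simp: wreath_top_permutes, auto simp: wreath_top_def fun_eq_iff)

lemma group_hom_wreath_base:
  "x \<in> X \<Longrightarrow> group_hom (Sym B) (Sym (B \<times> X)) (wreath_base x)"
  by (intro group_hom.intro group_hom_axioms.intro group_Sym homI)
    (auto simp: wreath_base_permutes, auto simp: wreath_base_def fun_eq_iff)

lemma wreath_generators_permute:
  "{wreath_top B \<tau> | \<tau>. \<tau> \<in> carrier (Sym X)} \<union>
   {wreath_base x \<sigma> | x \<sigma>. x \<in> X \<and> \<sigma> \<in> carrier (Sym B)} \<subseteq> carrier (Sym (B \<times> X))"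
  by (auto simp: wreath_top_permutes wreath_base_permutes)

text \<open>Copies of \<open>H\<close> are moved as a whole, so their edges survive. Edges in the
  root row follow \<tau>, so only the one over the exceptional edge of \<tau> can be lost.\<close>

lemma wreath_top_all_Fer:
  assumes G: "labeled_graph G" and H: "labeled_graph H" and v: "v \<in> verts H"
    and \<tau>: "\<tau> \<in> all_Fer G"
  shows "wreath_top (labels H) \<tau> \<in> all_Fer (comb_product G H v)"
proof -
  obtain e where per: "\<tau> permutes labels G"
    and e: "\<And>f. f \<in> label_edges G \<Longrightarrow> f \<noteq> e \<Longrightarrow> \<tau> ` f \<in> label_edges G"
    using \<tau> unfolding all_Fer_iff [OF G] by blast
  note L = label_edges_comb_product [OF G H v]
  have "wreath_top (labels H) \<tau> ` f \<in> label_edges (comb_product G H v)"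
    if f: "f \<in> label_edges (comb_product G H v)" and ne: "f \<noteq> {label H v} \<times> e" for f
  proof -
    consider g where "g \<in> label_edges G" "f = {label H v} \<times> g"
      | g x where "g \<in> label_edges H" "x \<in> labels G" "f = g \<times> {x}"
      using f by (elim label_edge_comb_productE [OF G H v])
    then show ?thesis
    proof cases
      case 1
      then have "wreath_top (labels H) \<tau> ` f = {label H v} \<times> \<tau> ` g"
        using v H by (auto simp: wreath_top_def label_in_labels image_iff)
      moreover have "\<tau> ` g \<in> label_edges G" using 1 e ne by auto
      ultimately show ?thesis unfolding L by auto
    next
      case 2
      then have "wreath_top (labels H) \<tau> ` f = g \<times> {\<tau> x}"
        using subsetD [OF label_edges_subset [OF H] 2(1)]
        by (auto simp: wreath_top_def image_iff subset_iff split: if_splits)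
      moreover have "\<tau> x \<in> labels G" using 2 per by (simp add: permutes_in_image)
      ultimately show ?thesis using 2 unfolding L by auto
    qed
  qed
  then show ?thesis
    unfolding all_Fer_iff [OF labeled_graph_comb_product [OF G H v]]
    using wreath_top_permutes [OF per] by auto
qed

text \<open>Only the copy at \<open>x\<close> is altered: an edge in another copy is left in place,
  and one in this copy survives if \<sigma> keeps it. This serves both kinds of permutations of a
  single copy.\<close>

lemma wreath_base_edges_H:
  assumes "\<sigma> ` g \<in> label_edges H \<or> x \<noteq> y" "g \<in> label_edges H" "y \<in> labels G"
    and "labeled_graph G" "labeled_graph H" "v \<in> verts H"
  shows "wreath_base x \<sigma> ` (g \<times> {y}) \<in> label_edges (comb_product G H v)"
proof -
  have "wreath_base x \<sigma> ` (g \<times> {y}) = (if y = x then \<sigma> ` g else g) \<times> {y}"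
    by (auto simp: wreath_base_def image_iff)
  then show ?thesis
    using assms by (auto simp: label_edges_comb_product)
qed

text \<open>As the root label is fixed, every edge coming from \<open>G\<close> is fixed pointwise;
  only the exceptional edge of \<sigma>, in the copy at \<open>x\<close>, is at risk.\<close>

lemma wreath_base_all_Fer:
  assumes G: "labeled_graph G" and H: "labeled_graph H" and v: "v \<in> verts H"
    and \<sigma>: "\<sigma> \<in> all_Fer H" "\<sigma> (label H v) = label H v" and x: "x \<in> labels G"
  shows "wreath_base x \<sigma> \<in> all_Fer (comb_product G H v)"
proof -
  obtain e where per: "\<sigma> permutes labels H"
    and e: "\<And>f. f \<in> label_edges H \<Longrightarrow> f \<noteq> e \<Longrightarrow> \<sigma> ` f \<in> label_edges H"
    using \<sigma>(1) unfolding all_Fer_iff [OF H] by blast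
  have "wreath_base x \<sigma> ` f \<in> label_edges (comb_product G H v)"
    if f: "f \<in> label_edges (comb_product G H v)" and ne: "f \<noteq> e \<times> {x}" for f
  proof -
    consider g where "g \<in> label_edges G" "f = {label H v} \<times> g"
      | g y where "g \<in> label_edges H" "y \<in> labels G" "f = g \<times> {y}"
      using f by (elim label_edge_comb_productE [OF G H v])
    then show ?thesis
    proof cases
      case 1
      then have "wreath_base x \<sigma> ` f = f"
        using \<sigma>(2) by (auto simp: wreath_base_def image_iff split: if_splits)
      then show ?thesis using f by simp
    next
      case 2
      then show ?thesis
        using e ne G H v wreath_base_edges_H [of \<sigma> g H x y G v] by blast
    qed
  qed
  then show ?thesis
    unfolding all_Fer_iff [OF labeled_graph_comb_product [OF G H v]]
    using wreath_base_permutes [OF per x] by auto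
qed

text \<open>
  Applying an automorphism of \<open>H\<close> in the copy at a leaf only re-hangs that copy: the single
  edge joining it to the rest of the graph is the one that moves.
\<close>

lemma wreath_base_leaf_all_Fer:
  assumes G: "labeled_graph G" and H: "labeled_graph H" and v: "v \<in> verts H"
    and \<phi>: "\<phi> \<in> Aut H" and u: "leaf G u"
  shows "wreath_base (label G u) \<phi> \<in> all_Fer (comb_product G H v)"
proof -
  let ?x = "label G u"
  have uG: "u \<in> verts G" using u by (simp add: leaf_def)
  \<comment> \<open>The unique neighbour of the leaf; the edge between their root vertices is the
    one that may be lost.\<close>
  obtain w where w: "{w' \<in> verts G. {u, w'} \<in> edges G} = {w}"
  proof -
    have "card {w' \<in> verts G. {u, w'} \<in> edges G} = 1"
      using u by (simp add: leaf_def degree_def)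
    then show ?thesis using that by (rule card_1_singletonE)
  qed
  have leaf_edge: "g = {?x, label G w}" if g: "g \<in> label_edges G" "?x \<in> g" for g
  proof -
    obtain f where f: "f \<in> edges G" "g = label G ` f"
      using g(1) by (auto simp: label_edges_eq [OF G])
    obtain a b where ab: "a \<in> verts G" "b \<in> verts G" "f = {a, b}"
      using G f(1) by (elim labeled_graph_edgeE)
    have "inj_on (label G) (verts G)"
      using G by (simp add: labeled_graph_def bij_betw_def)
    then have "u = a \<or> u = b"
      using g(2) f ab uG by (auto simp: inj_on_def)
    then obtain c where c: "c \<in> verts G" "f = {u, c}"
      using ab by (auto simp: insert_commute)
    then have "c \<in> {w' \<in> verts G. {u, w'} \<in> edges G}"
      using f(1) by simp
    then have "c = w" unfolding w by simp
    then show ?thesis using f(2) c(2) by simp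
  qed
  have per: "\<phi> permutes labels H" using \<phi> by (simp add: Aut_def)
  have "wreath_base ?x \<phi> ` f \<in> label_edges (comb_product G H v)"
    if f: "f \<in> label_edges (comb_product G H v)" and ne: "f \<noteq> {label H v} \<times> {?x, label G w}" for f
  proof -
    consider g where "g \<in> label_edges G" "f = {label H v} \<times> g"
      | g y where "g \<in> label_edges H" "y \<in> labels G" "f = g \<times> {y}"
      using f by (elim label_edge_comb_productE [OF G H v])
    then show ?thesis
    proof cases
      case 1
      \<comment> \<open>The only edge of \<open>G\<close> through the leaf is excluded by
        \<open>ne\<close>, so \<open>f\<close> has no vertex in the permuted copy.\<close>
      then have "?x \<notin> g" using leaf_edge ne by auto
      with 1 have "wreath_base ?x \<phi> ` f = f"
        by (force simp: wreath_base_def image_iff split: if_splits)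
      then show ?thesis using f by simp
    next
      case 2
      then show ?thesis
        using wreath_base_edges_H [OF _ 2(1,2) G H v] Aut_maps_edges [OF H \<phi> 2(1)] by simp
    qed
  qed
  then show ?thesis
    unfolding all_Fer_iff [OF labeled_graph_comb_product [OF G H v]]
    using wreath_base_permutes [OF per label_in_labels [OF G uG]] by auto
qed

section \<open>Maximality of the wreath product\<close>

lemma inv_Sym:
  assumes "\<sigma> permutes X"
  shows "inv\<^bsub>Sym X\<^esub> \<sigma> = Hilbert_Choice.inv \<sigma>"
  by (rule group.inv_equality [OF group_Sym])
    (simp_all add: assms permutes_inv permutes_inv_o [OF assms])

lemma
  assumes "subgroup K (Sym X)"
  shows subgroup_Sym_permutes: "\<sigma> \<in> K \<Longrightarrow> \<sigma> permutes X"
    and subgroup_Sym_comp: "\<sigma> \<in> K \<Longrightarrow> \<tau> \<in> K \<Longrightarrow> \<sigma> \<circ> \<tau> \<in> K"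
    and subgroup_Sym_id: "id \<in> K"
    and subgroup_Sym_inv: "\<sigma> \<in> K \<Longrightarrow> Hilbert_Choice.inv \<sigma> \<in> K"
proof -
  show per: "\<sigma> permutes X" if "\<sigma> \<in> K" for \<sigma>
    using subgroup.subset [OF assms] that by auto
  show "\<sigma> \<in> K \<Longrightarrow> \<tau> \<in> K \<Longrightarrow> \<sigma> \<circ> \<tau> \<in> K"
    using subgroup.m_closed [OF assms] by simp
  show "id \<in> K"
    using subgroup.one_closed [OF assms] by simp
  show "\<sigma> \<in> K \<Longrightarrow> Hilbert_Choice.inv \<sigma> \<in> K"
    using subgroup.m_inv_closed [OF assms] per inv_Sym by metis
qed

lemma transpose_conj:
  assumes "\<pi> permutes X"
  shows "\<pi> \<circ> Transposition.transpose a b \<circ> Hilbert_Choice.inv \<pi> =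
    Transposition.transpose (\<pi> a) (\<pi> b)"
  using permutes_inverses [OF assms] permutes_inj [OF assms]
  by (auto simp: fun_eq_iff Transposition.transpose_def inj_eq)

lemma subgroup_Sym_transpose_conj:
  assumes "subgroup K (Sym X)" "\<pi> \<in> K" "Transposition.transpose a b \<in> K"
  shows "Transposition.transpose (\<pi> a) (\<pi> b) \<in> K"
  using subgroup_Sym_comp [OF assms(1) subgroup_Sym_comp [OF assms] subgroup_Sym_inv [OF assms(1,2)]]
    transpose_conj [OF subgroup_Sym_permutes [OF assms(1,2)]] by simp

lemma subgroup_wreath_product:
  "subgroup (wreath_product B X (carrier (Sym B)) (carrier (Sym X))) (Sym (B \<times> X))"
  unfolding wreath_product_def
  by (rule group.generate_is_subgroup [OF group_Sym wreath_generators_permute])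

lemma wreath_top_in_wreath_product:
  "\<tau> permutes X \<Longrightarrow> wreath_top B \<tau> \<in> wreath_product B X (carrier (Sym B)) (carrier (Sym X))"
  unfolding wreath_product_def by (rule generate.incl) auto

lemma wreath_base_in_wreath_product:
  "\<sigma> permutes B \<Longrightarrow> x \<in> X \<Longrightarrow>
   wreath_base x \<sigma> \<in> wreath_product B X (carrier (Sym B)) (carrier (Sym X))"
  unfolding wreath_product_def by (rule generate.incl) auto

text \<open>Transpositions generate the symmetric group of a finite set, so it suffices to find all
  of them in \<open>K\<close>, first within blocks and then across.\<close>

lemma subgroup_over_wreath_product_eq_Sym:
  assumes K: "subgroup K (Sym (B \<times> X))" and fin: "finite B" "finite X"
    and W: "wreath_product B X (carrier (Sym B)) (carrier (Sym X)) \<subseteq> K"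
    and \<pi>: "\<pi> \<in> K" "\<not> respects_blocks B X \<pi>"
  shows "K = carrier (Sym (B \<times> X))"
proof -
  have top: "wreath_top B \<tau> \<in> K" if "\<tau> permutes X" for \<tau>
    using W wreath_top_in_wreath_product [OF that] by blast
  have base: "wreath_base x \<sigma> \<in> K" if "\<sigma> permutes B" "x \<in> X" for x \<sigma>
    using W wreath_base_in_wreath_product [OF that] by blast
  have per: "\<pi> permutes B \<times> X"
    by (rule subgroup_Sym_permutes [OF K \<pi>(1)])
  have in_block: "Transposition.transpose (b, x) (c, x) \<in> K"
    if "b \<in> B" "c \<in> B" "x \<in> X" for b c x
  proof -
    have "Transposition.transpose (b, x) (c, x) = wreath_base x (Transposition.transpose b c)"
      by (auto simp: fun_eq_iff wreath_base_def Transposition.transpose_def)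
    then show ?thesis using base that by (simp add: permutes_swap_id)
  qed
  have "\<exists>b\<in>B. \<exists>c\<in>B. \<exists>x\<in>X. snd (\<pi> (b, x)) \<noteq> snd (\<pi> (c, x))"
  proof (rule ccontr)
    assume "\<not> ?thesis"
    then have same: "snd (\<pi> (b, x)) = snd (\<pi> (c, x))" if "b \<in> B" "c \<in> B" "x \<in> X" for b c x
      using that by blast
    have "\<exists>y\<in>X. \<pi> ` (B \<times> {x}) = B \<times> {y}" if x: "x \<in> X" for x
    proof (cases "B = {}")
      case False
      then obtain b where b: "b \<in> B" by auto
      let ?y = "snd (\<pi> (b, x))"
      have \<pi>_in: "\<pi> (c, x) \<in> B \<times> X" if "c \<in> B" for c
        using that x permutes_in_image [OF per, of "(c, x)"] by simp
      have "\<pi> ` (B \<times> {x}) \<subseteq> B \<times> {?y}"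
        using \<pi>_in same [OF _ b x] by (fastforce simp: mem_Times_iff)
      \<comment> \<open>The image of a block lies in one block; equality of finite sizes makes it
        the whole block.\<close>
      moreover have "card (\<pi> ` (B \<times> {x})) = card (B \<times> {?y})"
        using permutes_inj_on [OF per] by (simp add: card_image card_cartesian_product)
      ultimately have "\<pi> ` (B \<times> {x}) = B \<times> {?y}"
        using fin by (intro card_subset_eq) auto
      then show ?thesis using \<pi>_in [OF b] by (auto simp: mem_Times_iff)
    \<comment> \<open>For empty \<open>B\<close> all blocks are empty, and \<open>x\<close> itself
      serves as \<open>y\<close>.\<close>
    qed (use x in auto)
    then show False using \<pi>(2) by (simp add: respects_blocks_def)
  qed
  then obtain b c x
    where bcx: "b \<in> B" "c \<in> B" "x \<in> X" "snd (\<pi> (b, x)) \<noteq> snd (\<pi> (c, x))"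
    by blast
  define a1 x1 a2 x2 where "a1 = fst (\<pi> (b, x))" and "x1 = snd (\<pi> (b, x))"
    and "a2 = fst (\<pi> (c, x))" and "x2 = snd (\<pi> (c, x))"
  have mem: "a1 \<in> B" "x1 \<in> X" "a2 \<in> B" "x2 \<in> X" "x1 \<noteq> x2"
    using bcx permutes_in_image [OF per, of "(b, x)"] permutes_in_image [OF per, of "(c, x)"]
    by (auto simp: a1_def x1_def a2_def x2_def mem_Times_iff)
  have cross0: "Transposition.transpose (a1, x1) (a2, x2) \<in> K"
    using subgroup_Sym_transpose_conj [OF K \<pi>(1) in_block [OF bcx(1-3)]]
    by (simp add: a1_def x1_def a2_def x2_def)
  have cross: "Transposition.transpose (c1, y1) (c2, y2) \<in> K"
    if c: "c1 \<in> B" "c2 \<in> B" "y1 \<in> X" "y2 \<in> X" "y1 \<noteq> y2" for c1 c2 y1 y2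
  proof -
    \<comment> \<open>\<open>z\<close> is where \<open>x2\<close> lands once \<open>x1\<close> has
      been swapped to \<open>y1\<close>. Neither \<open>z\<close> nor \<open>y2\<close> equals
      \<open>y1\<close>, so swapping \<open>z\<close> with \<open>y2\<close> sends \<open>x2\<close>
      on to \<open>y2\<close> and leaves \<open>y1\<close> in place.\<close>
    define z where "z = Transposition.transpose x1 y1 x2"
    define \<tau> where "\<tau> = Transposition.transpose z y2 \<circ> Transposition.transpose x1 y1"
    have z: "z \<in> X" "z \<noteq> y1"
      using mem c by (auto simp: z_def Transposition.transpose_def)
    then have \<tau>: "\<tau> permutes X" "\<tau> x1 = y1" "\<tau> x2 = y2"
      using mem c by (auto simp: \<tau>_def z_def [symmetric] permutes_swap_id intro!: permutes_compose)
    \<comment> \<open>\<tau> brings the two points into the right blocks; one transposition in each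
      block then corrects the first coordinate. They do not interfere since
      \<open>y1 \<noteq> y2\<close>.\<close>
    let ?\<rho> = "wreath_base y2 (Transposition.transpose a2 c2) \<circ>
      (wreath_base y1 (Transposition.transpose a1 c1) \<circ> wreath_top B \<tau>)"
    have "?\<rho> \<in> K"
      using \<tau>(1) mem c by (intro subgroup_Sym_comp [OF K] base top) (auto simp: permutes_swap_id)
    moreover have "?\<rho> (a1, x1) = (c1, y1)" "?\<rho> (a2, x2) = (c2, y2)"
      using \<tau> mem c by (auto simp: wreath_base_def wreath_top_def)
    ultimately show ?thesis
      using subgroup_Sym_transpose_conj [OF K _ cross0, of ?\<rho>] by simp
  qed
  have trans: "Transposition.transpose p q \<in> K" if "p \<in> B \<times> X" "q \<in> B \<times> X" for p q
    using that in_block cross by (cases p; cases q) (metis SigmaE2)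
  have "\<sigma> \<in> K" if "\<sigma> permutes B \<times> X" for \<sigma>
    using that finite_cartesian_product [OF fin]
  proof (induction rule: permutes_induct)
    case (swap a b p)
    then show ?case using subgroup_Sym_comp [OF K trans] by blast
  qed (rule subgroup_Sym_id [OF K])
  then show ?thesis
    using subgroup_Sym_permutes [OF K] by auto
qed

text \<open>Such a permutation acts inside each block by some \<open>s x\<close> and then moves the
  blocks by \<tau>, which writes it as a product of generators. Hence a group containing the wreath
  product and respecting the blocks is no larger.\<close>

lemma respects_blocks_in_wreath_product:
  assumes fin: "finite B" "finite X" and "B \<noteq> {}"
    and per: "\<pi> permutes B \<times> X" and resp: "respects_blocks B X \<pi>"
  shows "\<pi> \<in> wreath_product B X (carrier (Sym B)) (carrier (Sym X))" (is "_ \<in> ?W")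
proof -
  note W = subgroup_wreath_product [of B X]
  have \<pi>_in: "\<pi> (b, x) \<in> B \<times> X" if "b \<in> B" "x \<in> X" for b x
    using that permutes_in_image [OF per, of "(b, x)"] by simp
  have inj: "b = c \<and> x = y" if "\<pi> (b, x) = \<pi> (c, y)" for b c x y
    using injD [OF permutes_inj [OF per] that] by simp
  obtain b0 where b0: "b0 \<in> B" using \<open>B \<noteq> {}\<close> by auto
  \<comment> \<open>The target block is read off at the single point \<open>b0\<close>;
    \<open>block\<close> shows that the choice does not matter. The identity outside
    \<open>X\<close> and \<open>B\<close> is what \<open>permutes\<close> requires.\<close>
  define \<tau> where "\<tau> x = (if x \<in> X then snd (\<pi> (b0, x)) else x)" for x
  define s where "s x b = (if b \<in> B then fst (\<pi> (b, x)) else b)" for x b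
  have block: "\<pi> ` (B \<times> {x}) = B \<times> {\<tau> x}" if x: "x \<in> X" for x
  proof -
    obtain y where "\<pi> ` (B \<times> {x}) = B \<times> {y}"
      using resp x unfolding respects_blocks_def by blast
    moreover from this have "\<pi> (b0, x) \<in> B \<times> {y}" using b0 by blast
    ultimately show ?thesis using x by (auto simp: \<tau>_def)
  qed
  have \<pi>_eq: "\<pi> (b, x) = (s x b, \<tau> x)" if "b \<in> B" "x \<in> X" for b x
  proof -
    have "\<pi> (b, x) \<in> B \<times> {\<tau> x}"
      using block [OF that(2)] that by blast
    then show ?thesis using that by (auto simp: s_def)
  qed
  have \<tau>: "\<tau> permutes X"
  proof (rule inj_imp_permutes [OF _ fin(2)])
    show "inj_on \<tau> X"
    proof (rule inj_onI)
      fix x y assume xy: "x \<in> X" "y \<in> X" "\<tau> x = \<tau> y"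
      then have "\<pi> ` (B \<times> {x}) = \<pi> ` (B \<times> {y})" by (simp add: block)
      then have "\<pi> (b0, x) \<in> \<pi> ` (B \<times> {y})" using b0 by blast
      then show "x = y" using inj by auto
    qed
  qed (use \<pi>_in b0 in \<open>auto simp: \<tau>_def mem_Times_iff\<close>)
  have s: "s x permutes B" if "x \<in> X" for x
  proof (rule inj_imp_permutes [OF _ fin(1)])
    show "inj_on (s x) B"
    proof (rule inj_onI)
      fix b c assume "b \<in> B" "c \<in> B" "s x b = s x c"
      then have "\<pi> (b, x) = \<pi> (c, x)" using that by (simp add: \<pi>_eq)
      then show "b = c" using inj by blast
    qed
  qed (use \<pi>_in that in \<open>auto simp: s_def mem_Times_iff\<close>)
  \<comment> \<open>The inner permutations are applied one block at a time, by induction on the set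
    \<open>Y\<close> of blocks already treated.\<close>
  have "(\<lambda>(b, x). if x \<in> Y then (s x b, x) else (b, x)) \<in> ?W" if "finite Y" "Y \<subseteq> X" for Y
    using that
  proof (induction rule: finite_induct)
    case empty
    then show ?case using subgroup_Sym_id [OF W] by (simp add: id_def case_prod_unfold)
  next
    case (insert y Y)
    have "(\<lambda>(b, x). if x \<in> insert y Y then (s x b, x) else (b, x)) =
        wreath_base y (s y) \<circ> (\<lambda>(b, x). if x \<in> Y then (s x b, x) else (b, x))"
      using insert.hyps by (auto simp: fun_eq_iff wreath_base_def)
    then show ?case
      using insert s subgroup_Sym_comp [OF W wreath_base_in_wreath_product] by (simp only:) blast
  qed
  from subgroup_Sym_comp [OF W wreath_top_in_wreath_product [OF \<tau>] this [OF fin(2) subset_refl]]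
  have "wreath_top B \<tau> \<circ> (\<lambda>(b, x). if x \<in> X then (s x b, x) else (b, x)) \<in> ?W" .
  moreover have "wreath_top B \<tau> \<circ> (\<lambda>(b, x). if x \<in> X then (s x b, x) else (b, x)) = \<pi>"
  proof (rule ext, clarify)
    fix b x
    show "(wreath_top B \<tau> \<circ> (\<lambda>(b, x). if x \<in> X then (s x b, x) else (b, x))) (b, x) = \<pi> (b, x)"
    proof (cases "(b, x) \<in> B \<times> X")
      case True
      \<comment> \<open>\<open>s x b\<close> stays in \<open>B\<close>, so the guard of
        \<open>wreath_top\<close> lets \<tau> act on the second coordinate.\<close>
      then show ?thesis
        using permutes_in_image [OF s, of x b] by (auto simp: wreath_top_def \<pi>_eq)
    next
      case False
      then have "\<pi> (b, x) = (b, x)" by (rule permutes_not_in [OF per])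
      then show ?thesis using False by (auto simp: wreath_top_def s_def \<tau>_def)
    qed
  qed
  ultimately show ?thesis by simp
qed

section \<open>The dichotomy for the Fer group of a comb product\<close>

theorem corollary3:
  fixes G :: "('u, 'x) lgraph" and H :: "('w, 'b) lgraph" and v :: 'w
    and X :: "'x set" and B :: "'b set"
  assumes "labeled_graph G" and "labels G = X"
    and "labeled_graph H" and "labels H = B"
    and "local_amoeba G" and "\<exists>u. leaf G u"
    and "v \<in> verts H" and "hang_symmetric H v"
  shows "subgroup (wreath_product B X (carrier (Sym B)) (carrier (Sym X)))
           (Sym (B \<times> X)\<lparr>carrier := Fer (comb_product G H v)\<rparr>) \<and>
         (Fer (comb_product G H v) = wreath_product B X (carrier (Sym B)) (carrier (Sym X)) \<or>
          Fer (comb_product G H v) = carrier (Sym (B \<times> X))) \<and>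
         ((\<exists>\<pi>\<in>Fer (comb_product G H v). \<not> respects_blocks B X \<pi>) \<longrightarrow>
          local_amoeba (comb_product G H v))"
proof -
  note G = assms(1) and X = assms(2) and H = assms(3) and B = assms(4) and v = assms(7)
  let ?C = "comb_product G H v"
  let ?W = "wreath_product B X (carrier (Sym B)) (carrier (Sym X))"
  have C: "labeled_graph ?C" by (rule labeled_graph_comb_product [OF G H v])
  have Fer_eq: "Fer ?C = generate (Sym (B \<times> X)) (all_Fer ?C)"
    by (simp add: Fer_def X B)
  have "all_Fer ?C \<subseteq> carrier (Sym (B \<times> X))"
    using all_Fer_iff [OF C] by (auto simp: X B)
  then have K: "subgroup (Fer ?C) (Sym (B \<times> X))"
    unfolding Fer_eq by (rule group.generate_is_subgroup [OF group_Sym])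
  have incl: "\<sigma> \<in> Fer ?C" if "\<sigma> \<in> all_Fer ?C" for \<sigma>
    unfolding Fer_eq using that by (rule generate.incl)
  have top: "wreath_top B \<tau> \<in> Fer ?C" if "\<tau> permutes X" for \<tau>
  proof -
    have "wreath_top B ` generate (Sym X) (all_Fer G) \<subseteq> Fer ?C"
    proof (rule group_hom.generate_img [OF group_hom_wreath_top, THEN equalityD2, THEN subset_trans])
      show "all_Fer G \<subseteq> carrier (Sym X)"
        using all_Fer_iff [OF G] by (auto simp: X)
      show "generate (Sym (B \<times> X)) (wreath_top B ` all_Fer G) \<subseteq> Fer ?C"
        using wreath_top_all_Fer [OF G H v] incl
        by (intro group.generate_subgroup_incl [OF group_Sym _ K]) (auto simp: B)
    qed
    moreover have "generate (Sym X) (all_Fer G) = carrier (Sym X)"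
      using assms(5) by (simp add: local_amoeba_def Fer_def X)
    ultimately show ?thesis using that by auto
  qed
  obtain u where u: "leaf G u" using assms(6) by auto
  define l where "l = label G u"
  have l: "l \<in> X" using u G X by (auto simp: l_def leaf_def label_in_labels)
  have base_leaf: "wreath_base l \<sigma> \<in> Fer ?C" if "\<sigma> permutes B" for \<sigma>
  proof -
    \<comment> \<open>The generators of the hang group at the root: those fixing the root label
      could act in any copy, but the automorphisms need the copy at a leaf.\<close>
    let ?S = "{\<sigma> \<in> all_Fer H. \<sigma> (label H v) = label H v} \<union> Aut H"
    have "wreath_base l ` generate (Sym B) ?S \<subseteq> Fer ?C"
    proof (rule group_hom.generate_img
          [OF group_hom_wreath_base [OF l], THEN equalityD2, THEN subset_trans])
      show "?S \<subseteq> carrier (Sym B)"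
        using all_Fer_iff [OF H] by (auto simp: B Aut_def)
      show "generate (Sym (B \<times> X)) (wreath_base l ` ?S) \<subseteq> Fer ?C"
        using wreath_base_all_Fer [OF G H v, of _ l] wreath_base_leaf_all_Fer [OF G H v _ u] incl l
        by (intro group.generate_subgroup_incl [OF group_Sym _ K]) (auto simp: X l_def)
    qed
    moreover have "generate (Sym B) ?S = carrier (Sym B)"
      using assms(8) by (simp add: hang_symmetric_def hang_group_def B)
    ultimately show ?thesis using that by auto
  qed
  have base: "wreath_base x \<sigma> \<in> Fer ?C" if \<sigma>: "\<sigma> permutes B" and x: "x \<in> X" for x \<sigma>
  proof -
    \<comment> \<open>\<open>?t\<close> is an involution exchanging the copies at \<open>l\<close>
      and \<open>x\<close>; conjugation by it carries the action in the leaf copy to the copy at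
      \<open>x\<close>.\<close>
    let ?t = "wreath_top B (Transposition.transpose l x)"
    have "?t \<in> Fer ?C" using l x by (intro top) (simp add: permutes_swap_id)
    then have "?t \<circ> wreath_base l \<sigma> \<circ> ?t \<in> Fer ?C"
      by (intro subgroup_Sym_comp [OF K] base_leaf \<sigma>)
    moreover have "?t \<circ> wreath_base l \<sigma> \<circ> ?t = wreath_base x \<sigma>"
      using \<sigma> by (auto simp: fun_eq_iff wreath_top_def wreath_base_def permutes_in_image
          permutes_not_in Transposition.transpose_def)
    ultimately show ?thesis by simp
  qed
  have W: "?W \<subseteq> Fer ?C"
    unfolding wreath_product_def
    by (rule group.generate_subgroup_incl [OF group_Sym _ K]) (use top base in auto)
  have fin: "finite B" "finite X"
    using finite_labels [OF G] finite_labels [OF H] X B by auto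
  have "B \<noteq> {}" using label_in_labels [OF H v] B by auto
  have full: "Fer ?C = carrier (Sym (B \<times> X))" if "\<pi> \<in> Fer ?C" "\<not> respects_blocks B X \<pi>" for \<pi>
    by (rule subgroup_over_wreath_product_eq_Sym [OF K fin W that])
  \<comment> \<open>Without an element that breaks a block, \<open>Fer\<close> lies inside the
    wreath product, which gives the other half of the dichotomy.\<close>
  have "Fer ?C = ?W" if "\<forall>\<pi>\<in>Fer ?C. respects_blocks B X \<pi>"
    using that W subgroup_Sym_permutes [OF K]
      respects_blocks_in_wreath_product [OF fin \<open>B \<noteq> {}\<close>] by blast
  moreover have "subgroup ?W (Sym (B \<times> X)\<lparr>carrier := Fer ?C\<rparr>)"
    by (rule group.subgroup_incl [OF group_Sym subgroup_wreath_product K W])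
  ultimately show ?thesis
    using full unfolding local_amoeba_def labels_comb_product X B by blast
qed

end
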